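(* Let $X,Y_1,\dots,Y_n$ be independent real-valued continuous random variables, and suppose there are finite constants $K_1,\dots,K_n>0$ such that $I(X+Y_i;Y_i)\le\log K_i$, i.e. $h(X+Y_i)\leq h(X)+\log K_i$ for each $i$. Then $$h(X+Y_1+\cdots+Y_n)\leq h(X)+\log(K_1K_2\cdots K_n),$$ equivalently $I(X+Y_1+\cdots+Y_n;\,Y_1+\cdots+Y_n)\leq\log(K_1\cdots K_n)$.
   Context: Standing conventions: random variables are real-valued with densities and all differential entropies $h$ appearing exist and are finite. $I(U;V)=h(U)+h(V)-h(U,V)$ is mutual information; $\log$ is the natural logarithm. *)

theory Defs
  imports "HOL-Probability.Probability"
begin

definition has_density :: "'a measure \<Rightarrow> ('a \<Rightarrow> real) \<Rightarrow> bool" where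
  "has_density M X \<longleftrightarrow> (\<exists>f. distributed M lborel X f)"

definition has_finite_diff_entropy :: "'a measure \<Rightarrow> ('a \<Rightarrow> real) \<Rightarrow> bool" where
  "has_finite_diff_entropy M X \<longleftrightarrow>
     (\<exists>f. distributed M lborel X (\<lambda>x. ennreal (f x)) \<and> (\<forall>x. 0 \<le> f x) \<and>
          integrable lborel (\<lambda>x. f x * ln (f x)))"

text \<open>Differential entropy with natural logarithm (library entropy with base e,
  which equals - integral of f ln f for a density f).\<close>
definition diff_entropy :: "'a measure \<Rightarrow> ('a \<Rightarrow> real) \<Rightarrow> real" where
  "diff_entropy M X = prob_space.entropy M (exp 1) lborel X"

end

theory Submission
  imports Defs
begin

text \<open>
  For independent \<open>X\<close>, \<open>Y\<close>, \<open>Z\<close> let \<open>f\<close>, \<open>p\<close>, \<open>q\<close>, \<open>s\<close> be the densities of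
  \<open>X\<close>, \<open>X + Y\<close>, \<open>X + Z\<close>, \<open>X + Y + Z\<close>. The ratio
  \<open>r = p(X + Y) q(X + Z) / (f(X) s(X + Y + Z))\<close> has expectation at most 1: substituting
  \<open>w = x + y + z\<close> turns it into the integral of \<open>E[p(w - Z)] E[q(w - Y)] / s(w) = s(w)\<close>.
  Hence \<open>E[ln r] \<le> E[r] - 1 \<le> 0\<close>, which is the submodularity inequality
  \<open>h(X + Y + Z) + h(X) \<le> h(X + Y) + h(X + Z)\<close>, and the theorem follows by induction on the
  number of summands. The entropies of the partial sums are not assumed to be finite; they are,
  because \<open>ln s(X + Y + Z)\<close> lies between integrable functions: below by \<open>ln r \<le> r - 1\<close>,
  above by the same inequality for \<open>s(X + Y + Z) / f(X)\<close>, whose expectation is also at most 1.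
  Only the laws of \<open>Y\<close> and \<open>Z\<close> enter, so the induction can start from \<open>Y = 0\<close>.
\<close>

section \<open>Product laws and densities of independent sums\<close>

text \<open>Tonelli for the joint law. Independence enters as a product law, so \<open>X\<close> and
  \<open>V\<close> may have different types; \<open>V\<close> may then be a pair.\<close>

lemma (in prob_space) nn_integral_product_distr:
  assumes rv[measurable]: "X \<in> measurable M S" "V \<in> measurable M T"
    and eq: "distr M S X \<Otimes>\<^sub>M distr M T V = distr M (S \<Otimes>\<^sub>M T) (\<lambda>\<omega>. (X \<omega>, V \<omega>))"
    and [measurable]: "g \<in> borel_measurable (S \<Otimes>\<^sub>M T)"
  shows "(\<integral>\<^sup>+\<omega>. g (X \<omega>, V \<omega>) \<partial>M) = (\<integral>\<^sup>+\<omega>. (\<integral>\<^sup>+\<omega>'. g (X \<omega>', V \<omega>) \<partial>M) \<partial>M)"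
proof -
  interpret X: prob_space "distr M S X" by (rule prob_space_distr) fact
  interpret V: prob_space "distr M T V" by (rule prob_space_distr) fact
  interpret XV: pair_sigma_finite "distr M S X" "distr M T V" ..
  have "(\<integral>\<^sup>+\<omega>. g (X \<omega>, V \<omega>) \<partial>M) = integral\<^sup>N (distr M S X \<Otimes>\<^sub>M distr M T V) g"
    unfolding eq by (subst nn_integral_distr) auto
  also have "\<dots> = (\<integral>\<^sup>+v. (\<integral>\<^sup>+x. g (x, v) \<partial>distr M S X) \<partial>distr M T V)"
    by (subst XV.nn_integral_snd) auto
  also have "\<dots> = (\<integral>\<^sup>+\<omega>. (\<integral>\<^sup>+x. g (x, V \<omega>) \<partial>distr M S X) \<partial>M)"
    by (subst nn_integral_distr) auto
  also have "\<dots> = (\<integral>\<^sup>+\<omega>. (\<integral>\<^sup>+\<omega>'. g (X \<omega>', V \<omega>) \<partial>M) \<partial>M)"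
    using measurable_space[OF rv(2)]
    by (intro nn_integral_cong, subst nn_integral_distr) auto
  finally show ?thesis .
qed

lemma (in prob_space) nn_integral_indep_var_mult:
  assumes ind: "indep_var S Y T Z"
    and [measurable]: "a \<in> borel_measurable S" "b \<in> borel_measurable T"
  shows "(\<integral>\<^sup>+\<omega>. a (Y \<omega>) * b (Z \<omega>) \<partial>M) = (\<integral>\<^sup>+\<omega>. a (Y \<omega>) \<partial>M) * (\<integral>\<^sup>+\<omega>. b (Z \<omega>) \<partial>M)"
proof -
  have [measurable]: "Y \<in> measurable M S" "Z \<in> measurable M T"
    and eq: "distr M S Y \<Otimes>\<^sub>M distr M T Z = distr M (S \<Otimes>\<^sub>M T) (\<lambda>\<omega>. (Y \<omega>, Z \<omega>))"
    using ind unfolding indep_var_distribution_eq by auto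
  have "(\<integral>\<^sup>+\<omega>. a (Y \<omega>) * b (Z \<omega>) \<partial>M) = (\<integral>\<^sup>+\<omega>. (\<integral>\<^sup>+\<omega>'. a (Y \<omega>') * b (Z \<omega>) \<partial>M) \<partial>M)"
    using nn_integral_product_distr[OF _ _ eq, of "\<lambda>(y, z). a y * b z"] by simp
  also have "\<dots> = (\<integral>\<^sup>+\<omega>. (\<integral>\<^sup>+\<omega>'. a (Y \<omega>') \<partial>M) * b (Z \<omega>) \<partial>M)"
    by (intro nn_integral_cong nn_integral_multc) auto
  also have "\<dots> = (\<integral>\<^sup>+\<omega>. a (Y \<omega>) \<partial>M) * (\<integral>\<^sup>+\<omega>. b (Z \<omega>) \<partial>M)"
    by (rule nn_integral_cmult) auto
  finally show ?thesis .
qed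

lemma nn_integral_lborel_shift:
  fixes t :: real
  assumes "f \<in> borel_measurable borel"
  shows "(\<integral>\<^sup>+x. f (x - t) \<partial>lborel) = (\<integral>\<^sup>+x. f x \<partial>lborel)"
  using nn_integral_real_affine[OF assms, of 1 "- t"] by simp

text \<open>Tonelli brings in the density of \<open>X\<close>; for fixed \<open>V\<close> the
  translation \<open>x = w - c V\<close> makes \<open>w\<close> the value of \<open>X + c V\<close>,
  and a second exchange moves the integral over \<open>w\<close> outside.\<close>

lemma (in prob_space) nn_integral_density_shift:
  fixes X :: "'a \<Rightarrow> real"
  assumes X: "distributed M lborel X f" and [measurable]: "V \<in> measurable M T"
    and eq: "distr M borel X \<Otimes>\<^sub>M distr M T V = distr M (borel \<Otimes>\<^sub>M T) (\<lambda>\<omega>. (X \<omega>, V \<omega>))"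
    and [measurable]: "c \<in> borel_measurable T" "g \<in> borel_measurable (borel \<Otimes>\<^sub>M T)"
  shows "(\<integral>\<^sup>+\<omega>. g (X \<omega>, V \<omega>) \<partial>M) =
    (\<integral>\<^sup>+w. (\<integral>\<^sup>+\<omega>. f (w - c (V \<omega>)) * g (w - c (V \<omega>), V \<omega>) \<partial>M) \<partial>lborel)"
proof -
  have [measurable]: "X \<in> borel_measurable M"
    using distributed_measurable[OF X] by simp
  have [measurable]: "f \<in> borel_measurable borel"
    using distributed_borel_measurable[OF X] by simp
  interpret P: pair_sigma_finite lborel M ..
  have "(\<integral>\<^sup>+\<omega>. g (X \<omega>, V \<omega>) \<partial>M) = (\<integral>\<^sup>+\<omega>. (\<integral>\<^sup>+\<omega>'. g (X \<omega>', V \<omega>) \<partial>M) \<partial>M)"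
    by (rule nn_integral_product_distr[OF _ _ eq]) auto
  also have "\<dots> = (\<integral>\<^sup>+\<omega>. (\<integral>\<^sup>+x. f x * g (x, V \<omega>) \<partial>lborel) \<partial>M)"
    by (intro nn_integral_cong, subst distributed_nn_integral[OF X]) auto
  also have "\<dots> = (\<integral>\<^sup>+\<omega>. (\<integral>\<^sup>+w. f (w - c (V \<omega>)) * g (w - c (V \<omega>), V \<omega>) \<partial>lborel) \<partial>M)"
    by (intro nn_integral_cong
        nn_integral_lborel_shift[of "\<lambda>x. f x * g (x, V _)", symmetric]) auto
  also have "\<dots> = (\<integral>\<^sup>+w. (\<integral>\<^sup>+\<omega>. f (w - c (V \<omega>)) * g (w - c (V \<omega>), V \<omega>) \<partial>M) \<partial>lborel)"
    by (rule P.Fubini') measurable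
  finally show ?thesis .
qed

text \<open>The convolution is written as an expectation over \<open>Y\<close>, so the law of
  \<open>Y\<close> may be arbitrary, for instance a point mass.\<close>

lemma (in prob_space) distributed_add_indep:
  fixes X Y :: "'a \<Rightarrow> real"
  assumes ind: "indep_var borel X borel Y" and X: "distributed M lborel X f"
  shows "distributed M lborel (\<lambda>\<omega>. X \<omega> + Y \<omega>) (\<lambda>w. \<integral>\<^sup>+\<omega>. f (w - Y \<omega>) \<partial>M)"
  unfolding distributed_def
proof (intro conjI)
  have [measurable]: "X \<in> borel_measurable M" "Y \<in> borel_measurable M"
    and eq: "distr M borel X \<Otimes>\<^sub>M distr M borel Y = distr M (borel \<Otimes>\<^sub>M borel) (\<lambda>\<omega>. (X \<omega>, Y \<omega>))"
    using ind unfolding indep_var_distribution_eq by auto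
  have [measurable]: "f \<in> borel_measurable borel"
    using distributed_borel_measurable[OF X] by simp
  show "(\<lambda>w. \<integral>\<^sup>+\<omega>. f (w - Y \<omega>) \<partial>M) \<in> borel_measurable lborel"
    by measurable
  show "(\<lambda>\<omega>. X \<omega> + Y \<omega>) \<in> measurable M lborel"
    by measurable
  show "distr M lborel (\<lambda>\<omega>. X \<omega> + Y \<omega>) = density lborel (\<lambda>w. \<integral>\<^sup>+\<omega>. f (w - Y \<omega>) \<partial>M)"
  proof (rule measure_eqI)
    fix A :: "real set" assume "A \<in> sets (distr M lborel (\<lambda>\<omega>. X \<omega> + Y \<omega>))"
    then have A[measurable]: "A \<in> sets borel" by simp
    have "emeasure (distr M lborel (\<lambda>\<omega>. X \<omega> + Y \<omega>)) A =
        (\<integral>\<^sup>+w. indicator A w \<partial>distr M lborel (\<lambda>\<omega>. X \<omega> + Y \<omega>))"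
      by simp
    also have "\<dots> = (\<integral>\<^sup>+\<omega>. indicator A (X \<omega> + Y \<omega>) \<partial>M)"
      by (rule nn_integral_distr) auto
    also have "\<dots> = (\<integral>\<^sup>+w. (\<integral>\<^sup>+\<omega>. f (w - Y \<omega>) * indicator A w \<partial>M) \<partial>lborel)"
    proof -
      have "(\<lambda>(x, y). indicator A (x + y) :: ennreal) \<in> borel_measurable (borel \<Otimes>\<^sub>M borel)"
        by measurable
      \<comment> \<open>Here \<open>c\<close> is the identity: at \<open>x = w - Y\<close> the
        indicator of \<open>x + Y\<close> becomes \<open>indicator A w\<close>, which is constant on
        \<open>M\<close>.\<close>
      from nn_integral_density_shift[OF X \<open>Y \<in> borel_measurable M\<close> eq measurable_ident this]
      show ?thesis
        by (simp only: split_conv id_apply diff_add_cancel)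
    qed
    also have "\<dots> = (\<integral>\<^sup>+w. (\<integral>\<^sup>+\<omega>. f (w - Y \<omega>) \<partial>M) * indicator A w \<partial>lborel)"
      by (intro nn_integral_cong nn_integral_multc) auto
    also have "\<dots> = emeasure (density lborel (\<lambda>w. \<integral>\<^sup>+\<omega>. f (w - Y \<omega>) \<partial>M)) A"
      by (rule emeasure_density[symmetric]) auto
    finally show "emeasure (distr M lborel (\<lambda>\<omega>. X \<omega> + Y \<omega>)) A =
        emeasure (density lborel (\<lambda>w. \<integral>\<^sup>+\<omega>. f (w - Y \<omega>) \<partial>M)) A" .
  qed simp
qed

section \<open>Real densities and entropy as expected log-density\<close>

lemma (in prob_space) distributed_nn_integral_density:
  "distributed M N X f \<Longrightarrow> (\<integral>\<^sup>+x. f x \<partial>N) = 1"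
  using distributed_nn_integral[of M N X f "\<lambda>_. 1"] by (simp add: emeasure_space_1)

text \<open>A density has integral 1, hence is finite almost everywhere, and \<open>enn2real\<close>
  alters it only on a null set.\<close>

lemma (in prob_space) distributed_real_density:
  assumes X: "distributed M N X s"
  shows "distributed M N X (\<lambda>x. ennreal (enn2real (s x)))"
proof -
  have [measurable]: "s \<in> borel_measurable N"
    using X by (rule distributed_borel_measurable)
  have "AE x in N. s x \<noteq> \<infinity>"
    using distributed_nn_integral_density[OF X] by (intro nn_integral_PInf_AE) auto
  then have "AE x in N. ennreal (enn2real (s x)) = s x"
    by eventually_elim (simp add: top.not_eq_extremum)
  then show ?thesis
    using X by (subst distributed_cong_density[where g = s]) auto
qed

text \<open>The law of \<open>X\<close> gives mass 0 to the zero set of its own density. This is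
  what allows logarithms of ratios of densities to be split almost surely.\<close>

lemma AE_distributed_density_pos:
  assumes X: "distributed M N X (\<lambda>x. ennreal (f x))"
  shows "AE \<omega> in M. 0 < f (X \<omega>)"
proof -
  have m[measurable]: "(\<lambda>x. ennreal (f x)) \<in> borel_measurable N" "X \<in> measurable M N"
    using X by (auto simp: distributed_def)
  have "AE x in distr M N X. 0 < ennreal (f x)"
    unfolding distributed_distr_eq_density[OF X] by (subst AE_density) auto
  then have "AE \<omega> in M. 0 < ennreal (f (X \<omega>))"
    by (subst (asm) AE_distr_iff[OF m(2)]) (auto simp del: ennreal_less_zero_iff)
  then show ?thesis
    by simp
qed

text \<open>Moving from \<open>lborel\<close> to \<open>M\<close> puts the log-densities of
  different variables on one space, where they can be compared pointwise.\<close>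

lemma (in prob_space) diff_entropy_distributed:
  assumes X: "distributed M lborel X (\<lambda>x. ennreal (f x))" and nn: "\<And>x. 0 \<le> f x"
  shows "diff_entropy M X = - (\<integral>\<omega>. ln (f (X \<omega>)) \<partial>M)"
    and "integrable lborel (\<lambda>x. f x * ln (f x)) \<longleftrightarrow> integrable M (\<lambda>\<omega>. ln (f (X \<omega>)))"
proof -
  interpret information_space M "exp 1" by unfold_locales simp
  have [measurable]: "f \<in> borel_measurable borel"
    using distributed_real_measurable[OF _ X] nn by simp
  have "diff_entropy M X = - (\<integral>x. f x * ln (f x) \<partial>lborel)"
    unfolding diff_entropy_def using entropy_distr[OF X] nn by (simp add: log_def)
  then show "diff_entropy M X = - (\<integral>\<omega>. ln (f (X \<omega>)) \<partial>M)"
    using distributed_integral[OF X, of "\<lambda>x. ln (f x)"] nn by simp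
  show "integrable lborel (\<lambda>x. f x * ln (f x)) \<longleftrightarrow> integrable M (\<lambda>\<omega>. ln (f (X \<omega>)))"
    using distributed_integrable[OF X, of "\<lambda>x. ln (f x)"] nn by simp
qed

lemma has_finite_diff_entropyE:
  assumes "prob_space M" and "has_finite_diff_entropy M X"
  obtains f where "distributed M lborel X (\<lambda>x. ennreal (f x))" "\<And>x. 0 \<le> f x"
    "integrable M (\<lambda>\<omega>. ln (f (X \<omega>)))" "diff_entropy M X = - (\<integral>\<omega>. ln (f (X \<omega>)) \<partial>M)"
  using assms prob_space.diff_entropy_distributed[OF assms(1)]
  unfolding has_finite_diff_entropy_def by metis

section \<open>Integrability and ratio bounds\<close>

lemma integrable_sandwich:
  fixes f g h :: "'a \<Rightarrow> real"
  assumes "integrable M g" "integrable M h" "f \<in> borel_measurable M"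
    and "AE x in M. g x \<le> f x" "AE x in M. f x \<le> h x"
  shows "integrable M f"
proof (rule Bochner_Integration.integrable_bound)
  show "integrable M (\<lambda>x. \<bar>g x\<bar> + \<bar>h x\<bar>)" using assms by auto
  show "AE x in M. norm (f x) \<le> norm (\<bar>g x\<bar> + \<bar>h x\<bar>)"
    using assms(4,5) by eventually_elim auto
qed fact

lemma integrable_of_nn_integral_le_1:
  fixes r :: "'a \<Rightarrow> real"
  assumes [measurable]: "r \<in> borel_measurable M" and nn: "\<And>x. 0 \<le> r x"
    and le: "(\<integral>\<^sup>+x. ennreal (r x) \<partial>M) \<le> 1"
  shows "integrable M r" and "(\<integral>x. r x \<partial>M) \<le> 1"
proof -
  show i: "integrable M r"
    using le nn by (intro integrableI_nonneg) (auto simp: order_le_less_trans)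
  show "(\<integral>x. r x \<partial>M) \<le> 1"
    using le nn by (subst (asm) nn_integral_eq_integral[OF i]) auto
qed

text \<open>Division by 0 gives 0, so cancelling a density that may vanish yields only an
  inequality. Upper bounds on the expected ratios are all that is required.\<close>

lemma ennreal_mult_divide_le:
  fixes a b :: real
  assumes "0 \<le> a" "0 \<le> b"
  shows "ennreal a * ennreal (b / a) \<le> ennreal b"
  using assms by (cases "a = 0") (simp_all flip: ennreal_mult)

section \<open>Submodularity of differential entropy\<close>

text \<open>Each independence has its own task: \<open>iX_YZ\<close> permits the substitution
  \<open>w = x + y + z\<close>, \<open>iYZ\<close> factors an expectation, and \<open>iXY_Z\<close>,
  \<open>iXZ_Y\<close> give two formulas for the density of the full sum.\<close>

lemma (in prob_space) submodularity_diff_entropy: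
  fixes X Y Z :: "'a \<Rightarrow> real"
  assumes iX_YZ: "distr M borel X \<Otimes>\<^sub>M distr M (borel \<Otimes>\<^sub>M borel) (\<lambda>\<omega>. (Y \<omega>, Z \<omega>)) =
      distr M (borel \<Otimes>\<^sub>M borel \<Otimes>\<^sub>M borel) (\<lambda>\<omega>. (X \<omega>, Y \<omega>, Z \<omega>))"
    and iYZ: "indep_var borel Y borel Z"
    and iXY_Z: "indep_var borel (\<lambda>\<omega>. X \<omega> + Y \<omega>) borel Z"
    and iXZ_Y: "indep_var borel (\<lambda>\<omega>. X \<omega> + Z \<omega>) borel Y"
    and hX: "has_finite_diff_entropy M X"
    and hXY: "has_finite_diff_entropy M (\<lambda>\<omega>. X \<omega> + Y \<omega>)"
    and hXZ: "has_finite_diff_entropy M (\<lambda>\<omega>. X \<omega> + Z \<omega>)"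
  shows "has_finite_diff_entropy M (\<lambda>\<omega>. X \<omega> + Y \<omega> + Z \<omega>)"
    and "diff_entropy M (\<lambda>\<omega>. X \<omega> + Y \<omega> + Z \<omega>) + diff_entropy M X
      \<le> diff_entropy M (\<lambda>\<omega>. X \<omega> + Y \<omega>) + diff_entropy M (\<lambda>\<omega>. X \<omega> + Z \<omega>)"
proof -
  obtain f where f: "distributed M lborel X (\<lambda>x. ennreal (f x))" and fnn: "\<And>x. 0 \<le> f x"
    and fi: "integrable M (\<lambda>\<omega>. ln (f (X \<omega>)))"
    and fe: "diff_entropy M X = - (\<integral>\<omega>. ln (f (X \<omega>)) \<partial>M)"
    using has_finite_diff_entropyE[OF prob_space_axioms hX] by blast
  obtain p where p: "distributed M lborel (\<lambda>\<omega>. X \<omega> + Y \<omega>) (\<lambda>x. ennreal (p x))"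
    and pnn: "\<And>x. 0 \<le> p x" and pint: "integrable M (\<lambda>\<omega>. ln (p (X \<omega> + Y \<omega>)))"
    and pe: "diff_entropy M (\<lambda>\<omega>. X \<omega> + Y \<omega>) = - (\<integral>\<omega>. ln (p (X \<omega> + Y \<omega>)) \<partial>M)"
    using has_finite_diff_entropyE[OF prob_space_axioms hXY] by blast
  obtain q where q: "distributed M lborel (\<lambda>\<omega>. X \<omega> + Z \<omega>) (\<lambda>x. ennreal (q x))"
    and qnn: "\<And>x. 0 \<le> q x" and qint: "integrable M (\<lambda>\<omega>. ln (q (X \<omega> + Z \<omega>)))"
    and qe: "diff_entropy M (\<lambda>\<omega>. X \<omega> + Z \<omega>) = - (\<integral>\<omega>. ln (q (X \<omega> + Z \<omega>)) \<partial>M)"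
    using has_finite_diff_entropyE[OF prob_space_axioms hXZ] by blast
  \<comment> \<open>The density of \<open>(X + Y) + Z\<close>, obtained by averaging
    \<open>p\<close> over \<open>Z\<close>.\<close>
  define s where "s w = enn2real (\<integral>\<^sup>+\<omega>. ennreal (p (w - Z \<omega>)) \<partial>M)" for w
  note s1 = distributed_add_indep[OF iXY_Z p]
  have s: "distributed M lborel (\<lambda>\<omega>. X \<omega> + Y \<omega> + Z \<omega>) (\<lambda>w. ennreal (s w))"
    unfolding s_def by (rule distributed_real_density[OF s1])
  have snn: "0 \<le> s w" for w
    by (simp add: s_def)
  \<comment> \<open>The same sum grouped as \<open>(X + Z) + Y\<close>: averaging \<open>q\<close>
    over \<open>Y\<close> gives another version of its density.\<close>
  have s2: "distributed M lborel (\<lambda>\<omega>. X \<omega> + Y \<omega> + Z \<omega>) (\<lambda>w. \<integral>\<^sup>+\<omega>. ennreal (q (w - Y \<omega>)) \<partial>M)"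
    using distributed_add_indep[OF iXZ_Y q] by (simp add: add_ac)
  have [measurable]: "X \<in> borel_measurable M" "Y \<in> borel_measurable M" "Z \<in> borel_measurable M"
    using distributed_measurable[OF f] iYZ unfolding indep_var_distribution_eq by auto
  have [measurable]: "f \<in> borel_measurable borel" "p \<in> borel_measurable borel"
    "q \<in> borel_measurable borel" "s \<in> borel_measurable borel"
    using distributed_real_measurable[OF _ f] distributed_real_measurable[OF _ p]
      distributed_real_measurable[OF _ q] distributed_real_measurable[OF _ s] fnn pnn qnn snn
    by auto
  have int_s: "(\<integral>\<^sup>+w. ennreal (s w) \<partial>lborel) = 1"
    by (rule distributed_nn_integral_density[OF s])

  \<comment> \<open>Dividing by \<open>f (X \<omega>)\<close> last gives the shape
    \<open>b / a\<close> that cancels against the density \<open>f\<close> after the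
    substitution.\<close>
  define r where "r \<omega> = p (X \<omega> + Y \<omega>) * q (X \<omega> + Z \<omega>) / s (X \<omega> + Y \<omega> + Z \<omega>) / f (X \<omega>)" for \<omega>
  define r' where "r' \<omega> = s (X \<omega> + Y \<omega> + Z \<omega>) / f (X \<omega>)" for \<omega>
  have [measurable]: "r \<in> borel_measurable M" "r' \<in> borel_measurable M"
    unfolding r_def[abs_def] r'_def[abs_def] by measurable
  have rnn: "0 \<le> r \<omega>" "0 \<le> r' \<omega>" for \<omega>
    by (simp_all add: r_def r'_def fnn pnn qnn snn)

  \<comment> \<open>With \<open>c (y, z) = y + z\<close> the argument of \<open>s\<close> becomes
    \<open>w\<close>, and the new factor \<open>f\<close> cancels the denominator.\<close>
  have "(\<integral>\<^sup>+\<omega>. ennreal (r' \<omega>) \<partial>M) =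
      (\<integral>\<^sup>+w. (\<integral>\<^sup>+\<omega>. ennreal (f (w - (Y \<omega> + Z \<omega>))) * ennreal (s w / f (w - (Y \<omega> + Z \<omega>))) \<partial>M) \<partial>lborel)"
    using nn_integral_density_shift[OF f _ iX_YZ, of "\<lambda>(y, z). y + z"
        "\<lambda>(x, y, z). ennreal (s (x + y + z) / f x)"]
    by (simp add: r'_def add.assoc)
  also have "\<dots> \<le> (\<integral>\<^sup>+w. (\<integral>\<^sup>+\<omega>. ennreal (s w) \<partial>M) \<partial>lborel)"
    by (intro nn_integral_mono ennreal_mult_divide_le fnn snn)
  also have "\<dots> = 1"
    by (simp add: emeasure_space_1 int_s)
  finally have r'_le: "(\<integral>\<^sup>+\<omega>. ennreal (r' \<omega>) \<partial>M) \<le> 1" .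

  \<comment> \<open>Under \<open>x = w - (y + z)\<close> the arguments \<open>x + y\<close> and
    \<open>x + z\<close> turn into \<open>w - z\<close> and \<open>w - y\<close>.\<close>
  have "(\<integral>\<^sup>+\<omega>. ennreal (r \<omega>) \<partial>M) =
      (\<integral>\<^sup>+w. (\<integral>\<^sup>+\<omega>. ennreal (f (w - (Y \<omega> + Z \<omega>))) *
        ennreal (p (w - Z \<omega>) * q (w - Y \<omega>) / s w / f (w - (Y \<omega> + Z \<omega>))) \<partial>M) \<partial>lborel)"
    using nn_integral_density_shift[OF f _ iX_YZ, of "\<lambda>(y, z). y + z"
        "\<lambda>(x, y, z). ennreal (p (x + y) * q (x + z) / s (x + y + z) / f x)"]
    by (simp add: r_def algebra_simps)
  also have "\<dots> \<le> (\<integral>\<^sup>+w. (\<integral>\<^sup>+\<omega>. ennreal (p (w - Z \<omega>) * q (w - Y \<omega>) / s w) \<partial>M) \<partial>lborel)"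
    by (intro nn_integral_mono ennreal_mult_divide_le) (simp_all add: fnn pnn qnn snn)
  also have "\<dots> = (\<integral>\<^sup>+w. (\<integral>\<^sup>+\<omega>. ennreal (1 / s w) *
      (ennreal (q (w - Y \<omega>)) * ennreal (p (w - Z \<omega>))) \<partial>M) \<partial>lborel)"
    by (simp add: pnn qnn snn mult_ac flip: ennreal_mult)
  \<comment> \<open>For fixed \<open>w\<close> one factor depends on \<open>Y\<close> alone and the
    other on \<open>Z\<close> alone, so the expectation splits.\<close>
  also have "\<dots> = (\<integral>\<^sup>+w. ennreal (1 / s w) *
      ((\<integral>\<^sup>+\<omega>. ennreal (q (w - Y \<omega>)) \<partial>M) * (\<integral>\<^sup>+\<omega>. ennreal (p (w - Z \<omega>)) \<partial>M)) \<partial>lborel)"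
    by (intro nn_integral_cong)
      (simp add: nn_integral_cmult
        nn_integral_indep_var_mult[OF iYZ, of "\<lambda>y. ennreal (q (_ - y))" "\<lambda>z. ennreal (p (_ - z))"])
  \<comment> \<open>Both expectations are densities of the full sum, so by uniqueness each equals
    \<open>s\<close> almost everywhere.\<close>
  also have "\<dots> = (\<integral>\<^sup>+w. ennreal (1 / s w) * (ennreal (s w) * ennreal (s w)) \<partial>lborel)"
  proof (rule nn_integral_cong_AE)
    show "AE w in lborel. ennreal (1 / s w) *
        ((\<integral>\<^sup>+\<omega>. ennreal (q (w - Y \<omega>)) \<partial>M) * (\<integral>\<^sup>+\<omega>. ennreal (p (w - Z \<omega>)) \<partial>M)) =
        ennreal (1 / s w) * (ennreal (s w) * ennreal (s w))"
      using distributed_unique[OF s1 s] distributed_unique[OF s2 s]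
      by eventually_elim simp
  qed
  also have "\<dots> \<le> (\<integral>\<^sup>+w. ennreal (s w) \<partial>lborel)"
  proof (rule nn_integral_mono)
    fix w
    \<comment> \<open>Where \<open>s w = 0\<close> both sides are 0, since
      \<open>1 / 0 = 0\<close>.\<close>
    show "ennreal (1 / s w) * (ennreal (s w) * ennreal (s w)) \<le> ennreal (s w)"
      using snn[of w] by (cases "s w = 0") (simp_all flip: ennreal_mult)
  qed
  finally have r_le: "(\<integral>\<^sup>+\<omega>. ennreal (r \<omega>) \<partial>M) \<le> 1"
    by (simp add: int_s)

  note ri = integrable_of_nn_integral_le_1[OF _ rnn(1) r_le]
  note r'i = integrable_of_nn_integral_le_1[OF _ rnn(2) r'_le]
  have pos: "AE \<omega> in M. 0 < f (X \<omega>) \<and> 0 < p (X \<omega> + Y \<omega>) \<and> 0 < q (X \<omega> + Z \<omega>)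
      \<and> 0 < s (X \<omega> + Y \<omega> + Z \<omega>)"
    using AE_distributed_density_pos[OF f] AE_distributed_density_pos[OF p]
      AE_distributed_density_pos[OF q] AE_distributed_density_pos[OF s]
    by eventually_elim simp
  have lower: "AE \<omega> in M. ln (p (X \<omega> + Y \<omega>)) + ln (q (X \<omega> + Z \<omega>)) - ln (f (X \<omega>)) - (r \<omega> - 1)
      \<le> ln (s (X \<omega> + Y \<omega> + Z \<omega>))"
    using pos
  proof eventually_elim
    case (elim \<omega>)
    then have "ln (r \<omega>) \<le> r \<omega> - 1"
      by (intro ln_le_minus_one) (simp add: r_def)
    with elim show ?case
      by (simp add: r_def ln_div ln_mult)
  qed
  have upper: "AE \<omega> in M. ln (s (X \<omega> + Y \<omega> + Z \<omega>)) \<le> ln (f (X \<omega>)) + (r' \<omega> - 1)"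
    using pos
  proof eventually_elim
    case (elim \<omega>)
    then have "ln (r' \<omega>) \<le> r' \<omega> - 1"
      by (intro ln_le_minus_one) (simp add: r'_def)
    with elim show ?case
      by (simp add: r'_def ln_div)
  qed
  have li: "integrable M (\<lambda>\<omega>. ln (p (X \<omega> + Y \<omega>)) + ln (q (X \<omega> + Z \<omega>)) - ln (f (X \<omega>)) - (r \<omega> - 1))"
    using fi pint qint ri(1) by simp
  have si: "integrable M (\<lambda>\<omega>. ln (s (X \<omega> + Y \<omega> + Z \<omega>)))"
    using r'i(1) fi by (intro integrable_sandwich[OF li _ _ lower upper]) auto
  then show "has_finite_diff_entropy M (\<lambda>\<omega>. X \<omega> + Y \<omega> + Z \<omega>)"
    unfolding has_finite_diff_entropy_def
    using s snn diff_entropy_distributed(2)[OF s snn] by blast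
  have "(\<integral>\<omega>. ln (p (X \<omega> + Y \<omega>)) \<partial>M) + (\<integral>\<omega>. ln (q (X \<omega> + Z \<omega>)) \<partial>M)
      - (\<integral>\<omega>. ln (f (X \<omega>)) \<partial>M) - ((\<integral>\<omega>. r \<omega> \<partial>M) - 1)
      = (\<integral>\<omega>. ln (p (X \<omega> + Y \<omega>)) + ln (q (X \<omega> + Z \<omega>)) - ln (f (X \<omega>)) - (r \<omega> - 1) \<partial>M)"
    using fi pint qint ri(1) by (simp add: prob_space)
  also have "\<dots> \<le> (\<integral>\<omega>. ln (s (X \<omega> + Y \<omega> + Z \<omega>)) \<partial>M)"
    by (rule integral_mono_AE[OF li si lower])
  finally show "diff_entropy M (\<lambda>\<omega>. X \<omega> + Y \<omega> + Z \<omega>) + diff_entropy M X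
      \<le> diff_entropy M (\<lambda>\<omega>. X \<omega> + Y \<omega>) + diff_entropy M (\<lambda>\<omega>. X \<omega> + Z \<omega>)"
    using ri(2)[OF \<open>r \<in> borel_measurable M\<close>] diff_entropy_distributed(1)[OF s snn]
    unfolding fe pe qe by linarith
qed

section \<open>Functions of disjoint blocks of an independent family\<close>

lemma (in prob_space) indep_var_restrict_compose:
  assumes "indep_vars (\<lambda>_. borel) W I" "A \<inter> B = {}" "A \<subseteq> I" "B \<subseteq> I"
    and "F \<in> measurable (PiM A (\<lambda>_. borel)) S" "G \<in> measurable (PiM B (\<lambda>_. borel)) T"
  shows "indep_var S (\<lambda>\<omega>. F (\<lambda>i\<in>A. W i \<omega>)) T (\<lambda>\<omega>. G (\<lambda>i\<in>B. W i \<omega>))"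
  using indep_var_compose[OF indep_var_restrict[OF assms(1-4)] assms(5,6)] by (simp add: comp_def)

text \<open>\<^const>\<open>prob_space.indep_var\<close> forces both variables to have the same type, hence the
  formulation by product distributions when \<open>F\<close> and \<open>G\<close> map to different types.\<close>
lemma (in prob_space) product_distr_restrict_compose:
  assumes ind: "indep_vars (\<lambda>_. borel) W I" "A \<inter> B = {}" "A \<subseteq> I" "B \<subseteq> I"
    and F[measurable]: "F \<in> measurable (PiM A (\<lambda>_. borel)) S"
    and G[measurable]: "G \<in> measurable (PiM B (\<lambda>_. borel)) T"
  shows "distr M S (\<lambda>\<omega>. F (\<lambda>i\<in>A. W i \<omega>)) \<Otimes>\<^sub>M distr M T (\<lambda>\<omega>. G (\<lambda>i\<in>B. W i \<omega>)) =
    distr M (S \<Otimes>\<^sub>M T) (\<lambda>\<omega>. (F (\<lambda>i\<in>A. W i \<omega>), G (\<lambda>i\<in>B. W i \<omega>)))"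
proof -
  let ?P = "\<lambda>C. PiM C (\<lambda>_. borel)" and ?r = "\<lambda>C \<omega>. \<lambda>i\<in>C. W i \<omega>"
  have [measurable]: "?r A \<in> measurable M (?P A)" "?r B \<in> measurable M (?P B)"
    and eq: "distr M (?P A) (?r A) \<Otimes>\<^sub>M distr M (?P B) (?r B) =
      distr M (?P A \<Otimes>\<^sub>M ?P B) (\<lambda>\<omega>. (?r A \<omega>, ?r B \<omega>))"
    using indep_var_restrict[OF ind] unfolding indep_var_distribution_eq by auto
  \<comment> \<open>The second image measure is a probability, which provides the sigma-finiteness
    that \<open>pair_measure_distr\<close> asks for.\<close>
  have "prob_space (distr (distr M (?P B) (?r B)) T G)"
    by (intro prob_space.prob_space_distr prob_space_distr) auto
  then have sf: "sigma_finite_measure (distr (distr M (?P B) (?r B)) T G)"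
    by (simp add: prob_space_imp_sigma_finite)
  have "distr M S (\<lambda>\<omega>. F (?r A \<omega>)) \<Otimes>\<^sub>M distr M T (\<lambda>\<omega>. G (?r B \<omega>)) =
      distr (distr M (?P A) (?r A)) S F \<Otimes>\<^sub>M distr (distr M (?P B) (?r B)) T G"
    by (simp add: distr_distr comp_def)
  also have "\<dots> = distr (distr M (?P A) (?r A) \<Otimes>\<^sub>M distr M (?P B) (?r B)) (S \<Otimes>\<^sub>M T) (\<lambda>(x, y). (F x, G y))"
    by (rule pair_measure_distr[OF _ _ sf]) auto
  also have "\<dots> = distr M (S \<Otimes>\<^sub>M T) (\<lambda>\<omega>. (F (?r A \<omega>), G (?r B \<omega>)))"
    unfolding eq by (subst distr_distr) (auto simp: comp_def)
  finally show ?thesis .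
qed

section \<open>Induction on the number of summands\<close>

theorem mainTheorem11:
  fixes M :: "'a measure" and X :: "'a \<Rightarrow> real" and Y :: "nat \<Rightarrow> 'a \<Rightarrow> real"
    and K :: "nat \<Rightarrow> real" and n :: nat
  assumes "prob_space M"
    and indep: "prob_space.indep_vars M (\<lambda>_. borel) (\<lambda>i. if i = 0 then X else Y i) {0..n}"
    and contY: "\<And>i. i \<in> {1..n} \<Longrightarrow> has_density M (Y i)"
    and hX: "has_finite_diff_entropy M X"
    and hXY: "\<And>i. i \<in> {1..n} \<Longrightarrow> has_finite_diff_entropy M (\<lambda>\<omega>. X \<omega> + Y i \<omega>)"
    and hXS: "has_finite_diff_entropy M (\<lambda>\<omega>. X \<omega> + (\<Sum>i=1..n. Y i \<omega>))"
    and Kpos: "\<And>i. i \<in> {1..n} \<Longrightarrow> K i > 0"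
    and bound: "\<And>i. i \<in> {1..n} \<Longrightarrow>
       diff_entropy M (\<lambda>\<omega>. X \<omega> + Y i \<omega>) \<le> diff_entropy M X + ln (K i)"
  shows "diff_entropy M (\<lambda>\<omega>. X \<omega> + (\<Sum>i=1..n. Y i \<omega>))
           \<le> diff_entropy M X + ln (\<Prod>i=1..n. K i)"
proof -
  interpret prob_space M by fact
  let ?W = "\<lambda>i. if i = 0 then X else Y i"
  \<comment> \<open>Finiteness is carried along with the bound because submodularity takes the
    finite entropy of \<open>X\<close> plus the previous partial sum as input.\<close>
  have "k \<le> n \<Longrightarrow> has_finite_diff_entropy M (\<lambda>\<omega>. X \<omega> + (\<Sum>i=1..k. Y i \<omega>)) \<and>
    diff_entropy M (\<lambda>\<omega>. X \<omega> + (\<Sum>i=1..k. Y i \<omega>)) \<le> diff_entropy M X + ln (\<Prod>i=1..k. K i)" for k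
  proof (induction k)
    case 0
    then show ?case using hX by simp
  next
    case (Suc k)
    \<comment> \<open>\<open>?T\<close> and \<open>?Z\<close> play the roles of \<open>Y\<close> and
      \<open>Z\<close> in submodularity. For \<open>k = 0\<close> the sum \<open>?T\<close> is the
      constant 0.\<close>
    let ?T = "\<lambda>\<omega>. \<Sum>i=1..k. Y i \<omega>" and ?Z = "Y (Suc k)"
    have k: "Suc k \<in> {1..n}" "k \<le> n" using Suc.prems by auto
    have IH: "has_finite_diff_entropy M (\<lambda>\<omega>. X \<omega> + ?T \<omega>)"
      "diff_entropy M (\<lambda>\<omega>. X \<omega> + ?T \<omega>) \<le> diff_entropy M X + ln (\<Prod>i=1..k. K i)"
      using Suc.IH k by auto
    \<comment> \<open>The four independences come from splitting indices into disjoint blocks, with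
      index 0 standing for \<open>X\<close>. The pair \<open>(?T, ?Z)\<close> has a type other than
      that of \<open>X\<close>, so this one is a product law.\<close>
    have i1: "distr M borel X \<Otimes>\<^sub>M distr M (borel \<Otimes>\<^sub>M borel) (\<lambda>\<omega>. (?T \<omega>, ?Z \<omega>)) =
        distr M (borel \<Otimes>\<^sub>M borel \<Otimes>\<^sub>M borel) (\<lambda>\<omega>. (X \<omega>, ?T \<omega>, ?Z \<omega>))"
      using product_distr_restrict_compose[OF indep, of "{0}" "{1..Suc k}" "\<lambda>v. v 0" borel
          "\<lambda>v. (\<Sum>i=1..k. v i, v (Suc k))" "borel \<Otimes>\<^sub>M borel"] k
      by (simp add: measurable_component_singleton)
    have i2: "indep_var borel ?T borel ?Z"
      using indep_var_restrict_compose[OF indep, of "{1..k}" "{Suc k}" "\<lambda>v. \<Sum>i=1..k. v i" borel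
          "\<lambda>v. v (Suc k)" borel] k
      by simp
    have i3: "indep_var borel (\<lambda>\<omega>. X \<omega> + ?T \<omega>) borel ?Z"
      using indep_var_restrict_compose[OF indep, of "{0..k}" "{Suc k}"
          "\<lambda>v. v 0 + (\<Sum>i=1..k. v i)" borel "\<lambda>v. v (Suc k)" borel] k
      by simp
    have i4: "indep_var borel (\<lambda>\<omega>. X \<omega> + ?Z \<omega>) borel ?T"
      using indep_var_restrict_compose[OF indep, of "{0, Suc k}" "{1..k}"
          "\<lambda>v. v 0 + v (Suc k)" borel "\<lambda>v. \<Sum>i=1..k. v i" borel] k
      by simp
    \<comment> \<open>Adding \<open>?Z\<close> to \<open>X + ?T\<close> raises the entropy by at
      most as much as adding it to \<open>X\<close>, hence by at most
      \<open>ln (K (Suc k))\<close>.\<close>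
    note sub = submodularity_diff_entropy[OF i1 i2 i3 i4 hX IH(1) hXY[OF k(1)]]
    have "0 < (\<Prod>i=1..k. K i)" "0 < K (Suc k)"
      using Kpos k by (auto intro!: prod_pos)
    then have "ln (\<Prod>i=1..Suc k. K i) = ln (\<Prod>i=1..k. K i) + ln (K (Suc k))"
      by (simp add: ln_mult_pos)
    then show ?case
      using sub IH(2) bound[OF k(1)] by (simp add: add.assoc)
  qed
  from this[of n] show ?thesis by simp
qed

end
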